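(* Let $p$ be a prime number and let the binary operation $G:\mathbb{Z}_p\times\mathbb{Z}_p\to\mathbb{Z}_p$ be defined by a series, convergent for all $x,y\in\mathbb{Z}_p$, $$G(x,y)=c+ax+by+\sum_{k\ge 1}\ \sum_{i+j=n_k}c_{i,j}x^iy^j,\qquad a,b,c,c_{i,j}\in\mathbb{Z}_p,$$ with degree set $\mathcal{N}_G=\{n_1,n_2,\ldots\}$. If $\mathcal{N}_G=\emptyset$, assume $a\neq 0$ and $b\neq 0$. (i) If $\mathcal{N}_G\neq\emptyset$, then $\mathrm{Aut}\,\mathcal{A}_p(+,G)$ is nontrivial if and only if the following hold: 1. $c=0$; 2. there are an integer $d=p^sn$, with $s\ge 0$ an integer and $n$ a positive integer with $p\nmid n$, and positive integers $q_k$ such that $n_k=dq_k+1$ for every $n_k\in\mathcal{N}_G$; 3. (for this $d=p^sn$) $\gcd(n,p-1)\neq 1$ if $p\neq 2$, and $s=1$ if $p=2$. (ii) If $\mathcal{N}_G=\emptyset$, then $\mathrm{Aut}\,\mathcal{A}_p(+,G)$ is nontrivial if and only if $G(x,y)=ax+by$ with $a,b\in\mathbb{Z}_p$, $a,b\ne 0$. In all other cases $\mathrm{Aut}\,\mathcal{A}_p(+,G)$ is the trivial group.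
   Context: $\mathbb{Z}_p$ is the set of $p$-adic integers with its usual addition $+$. In the series for $G$, $\mathcal{N}_G=\{n_1,n_2,\ldots\}$ is a (finite, infinite or empty) set of integers with $1<n_1<n_2<\ldots$, such that for every $n_k\in\mathcal{N}_G$ there exist $i,j$ with $0\le i,j\le n_k$, $i+j=n_k$, and $c_{i,j}\neq 0$; i.e. $\mathcal{N}_G$ is exactly the set of total degrees $>1$ in which $G$ has a nonzero coefficient (if $n>1$ and $n\notin\mathcal{N}_G$ then $c_{i,j}=0$ for all $i+j=n$). $\mathcal{A}_p(+,G)$ denotes the algebraic system with carrier $\mathbb{Z}_p$, the binary operations $+$ and $G$, and the family of congruence relations modulo $p^k$ for all $k\ge 1$. An automorphism of $\mathcal{A}_p(+,G)$ is a bijective map $f:\mathbb{Z}_p\to\mathbb{Z}_p$ such that $f(x+y)=f(x)+f(y)$ and $f(G(x,y))=G(f(x),f(y))$ for all $x,y\in\mathbb{Z}_p$, and such that for every $k\ge 1$ and all $x,y\in\mathbb{Z}_p$, $x\equiv y\pmod{p^k}$ implies $f(x)\equiv f(y)\pmod{p^k}$. $\mathrm{Aut}\,\mathcal{A}_p(+,G)$ is the group of all automorphisms under composition; it is trivial if it consists only of the identity map. *)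

theory Defs
  imports Complex_Main "HOL-Library.Numeral_Type" "HOL-Computational_Algebra.Primes"
    "HOL-Algebra.Elementary_Groups"
begin

section \<open>The ring of p-adic integers\<close>

text \<open>
  The base is the cardinality \<^term>\<open>CARD('p)\<close> of an index type, as for the moduli of the
  library's numeral types; for example \<open>7 padic_int\<close> is the ring of 7-adic integers.
  An element is an element of the inverse limit of the rings of integers modulo
  \<^term>\<open>CARD('p) ^ k\<close>: its \<open>k\<close>-th component is the canonical residue in
  \<open>{0..<CARD('p) ^ k}\<close>. Class \<open>card2\<close> only asks for a finite base \<open>\<ge> 2\<close>;
  primality is a hypothesis of the theorem.
\<close>

typedef (overloaded) 'p padic_int =
  "{x :: nat \<Rightarrow> int. \<forall>k. x k = x (Suc k) mod int CARD('p::card2) ^ k}"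
  morphisms residue Abs_padic_int
  by (rule exI[of _ "\<lambda>_. 0"]) simp

setup_lifting type_definition_padic_int

lemma mod_power_Suc_mod: "(a::int) mod b ^ Suc k mod b ^ k = a mod b ^ k"
  by (rule mod_mod_cancel) (simp add: le_imp_power_dvd)

lemma residue_Suc_mod: "residue (x :: 'p::card2 padic_int) (Suc k) mod int CARD('p) ^ k = residue x k"
  using residue[of x, unfolded mem_Collect_eq] by metis

lemma residue_mod [simp]: "residue (x :: 'p::card2 padic_int) k mod int CARD('p) ^ k = residue x k"
  by (metis residue_Suc_mod mod_mod_trivial)

lemma padic_int_eqI: "(\<And>k. residue x k = residue y k) \<Longrightarrow> x = y"
  by (simp add: fun_eq_iff flip: residue_inject)

instantiation padic_int :: (card2) comm_ring_1
begin

lift_definition zero_padic_int :: "'a padic_int" is "\<lambda>_. 0" by simp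

lift_definition one_padic_int :: "'a padic_int" is "\<lambda>k. 1 mod int CARD('a) ^ k"
  by (simp only: mod_power_Suc_mod)

lift_definition plus_padic_int :: "'a padic_int \<Rightarrow> 'a padic_int \<Rightarrow> 'a padic_int"
  is "\<lambda>x y k. (x k + y k) mod int CARD('a) ^ k"
  unfolding mod_power_Suc_mod by (metis mod_add_eq)

lift_definition minus_padic_int :: "'a padic_int \<Rightarrow> 'a padic_int \<Rightarrow> 'a padic_int"
  is "\<lambda>x y k. (x k - y k) mod int CARD('a) ^ k"
  unfolding mod_power_Suc_mod by (metis mod_diff_eq)

lift_definition uminus_padic_int :: "'a padic_int \<Rightarrow> 'a padic_int"
  is "\<lambda>x k. (- x k) mod int CARD('a) ^ k"
  unfolding mod_power_Suc_mod by (metis mod_minus_eq)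

lift_definition times_padic_int :: "'a padic_int \<Rightarrow> 'a padic_int \<Rightarrow> 'a padic_int"
  is "\<lambda>x y k. (x k * y k) mod int CARD('a) ^ k"
  unfolding mod_power_Suc_mod by (metis mod_mult_eq)

lemmas residue_simps = zero_padic_int.rep_eq one_padic_int.rep_eq plus_padic_int.rep_eq
  minus_padic_int.rep_eq uminus_padic_int.rep_eq times_padic_int.rep_eq

instance
proof
  fix a b c :: "'a padic_int"
  show "a * b * c = a * (b * c)"
    by (rule padic_int_eqI) (simp add: residue_simps mod_simps mult.assoc)
  show "a * b = b * a"
    by (rule padic_int_eqI) (simp add: residue_simps mult.commute)
  show "1 * a = a"
    by (rule padic_int_eqI) (simp add: residue_simps mod_simps)
  show "a + b + c = a + (b + c)"
    by (rule padic_int_eqI) (simp add: residue_simps mod_simps add.assoc)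
  show "a + b = b + a"
    by (rule padic_int_eqI) (simp add: residue_simps add.commute)
  show "0 + a = a"
    by (rule padic_int_eqI) (simp add: residue_simps)
  show "- a + a = 0"
    by (rule padic_int_eqI) (simp add: residue_simps mod_simps)
  show "a - b = a + - b"
    by (rule padic_int_eqI) (simp add: residue_simps mod_simps)
  show "(a + b) * c = a * c + b * c"
    by (rule padic_int_eqI) (simp add: residue_simps mod_simps distrib_right)
  have "int CARD('a) > 1"
    using two_le_card[where 'a='a] by linarith
  then have "residue (0::'a padic_int) 1 \<noteq> residue 1 1"
    by (simp add: residue_simps)
  then show "(0::'a padic_int) \<noteq> 1"
    by metis
qed

end

lemma residue_mod_le:
  assumes "k \<le> l"
  shows "residue (x :: 'p::card2 padic_int) l mod int CARD('p) ^ k = residue x k"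
  using assms
proof (induction l rule: dec_induct)
  case base
  show ?case by (rule residue_mod)
next
  case (step l)
  have "residue x (Suc l) mod int CARD('p) ^ k
      = residue x (Suc l) mod int CARD('p) ^ l mod int CARD('p) ^ k"
    by (rule mod_mod_cancel[symmetric]) (rule le_imp_power_dvd[OF step.hyps(1)])
  then show ?case
    by (simp only: residue_Suc_mod step.IH)
qed

lemma residue_of_nat: "residue (of_nat n :: 'p::card2 padic_int) k = int n mod int CARD('p) ^ k"
  by (induction n) (simp_all add: residue_simps mod_simps)

lemma power_CARD_dvd_iff:
  fixes x :: "'p::card2 padic_int"
  shows "of_nat CARD('p) ^ k dvd x \<longleftrightarrow> residue x k = 0"
proof
  assume "of_nat CARD('p) ^ k dvd x"
  then obtain y where "x = of_nat (CARD('p) ^ k) * y"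
    by (auto simp: dvd_def)
  then show "residue x k = 0"
    by (simp only: times_padic_int.rep_eq residue_of_nat) simp
next
  let ?P = "int CARD('p)"
  have P: "?P > 0" by simp
  assume 0: "residue x k = 0"
  define f where "f j = residue x (j + k) div ?P ^ k" for j
  have dvd: "?P ^ k dvd residue x (j + k)" for j
    using residue_mod_le[of k "j + k" x] 0 by (simp add: mod_eq_0_iff_dvd)
  have f: "?P ^ k * f j = residue x (j + k)" for j
    using dvd[of j] by (simp add: f_def)
  have "f j = f (Suc j) mod ?P ^ j" for j
  proof -
    have "?P ^ k * (f (Suc j) mod ?P ^ j) = (?P ^ k * f (Suc j)) mod (?P ^ k * ?P ^ j)"
      by (rule mult_mod_right)
    also have "\<dots> = residue x (Suc (j + k)) mod ?P ^ (j + k)"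
      using f[of "Suc j"] by (simp only: power_add mult.commute add_Suc)
    also have "\<dots> = ?P ^ k * f j"
      by (simp only: residue_Suc_mod f)
    finally have "?P ^ k * (f (Suc j) mod ?P ^ j) = ?P ^ k * f j" .
    moreover have "?P ^ k \<noteq> 0"
      using P by simp
    ultimately show ?thesis
      by (simp only: mult_cancel_left) simp
  qed
  then have rep: "residue (Abs_padic_int f :: 'p padic_int) = f"
    by (intro Abs_padic_int_inverse CollectI allI)
  have "x = of_nat (CARD('p) ^ k) * Abs_padic_int f"
  proof (rule padic_int_eqI)
    fix j
    have "residue (of_nat (CARD('p) ^ k) * Abs_padic_int f :: 'p padic_int) j
        = (?P ^ k * f j) mod ?P ^ j"
      by (simp only: times_padic_int.rep_eq residue_of_nat rep)
        (simp only: of_nat_power mod_mult_left_eq)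
    also have "\<dots> = residue x j"
      by (simp only: f) (rule residue_mod_le, simp)
    finally show "residue x j = residue (of_nat (CARD('p) ^ k) * Abs_padic_int f :: 'p padic_int) j" ..
  qed
  then show "of_nat CARD('p) ^ k dvd x"
    by simp
qed

lemma padic_int_eq_0_iff:
  fixes x :: "'p::card2 padic_int"
  shows "x = 0 \<longleftrightarrow> (\<forall>k. of_nat CARD('p) ^ k dvd x)"
  by (simp add: power_CARD_dvd_iff flip: residue_inject) (simp add: zero_padic_int.rep_eq fun_eq_iff)


section \<open>The p-adic metric\<close>

definition padic_val :: "'p::card2 padic_int \<Rightarrow> nat"
  where "padic_val x = (GREATEST k. of_nat CARD('p) ^ k dvd x)"

lemma power_CARD_dvd_iff_le_val:
  fixes x :: "'p::card2 padic_int"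
  assumes "x \<noteq> 0"
  shows "of_nat CARD('p) ^ k dvd x \<longleftrightarrow> k \<le> padic_val x"
proof -
  let ?d = "\<lambda>k. of_nat CARD('p) ^ k dvd x"
  obtain m where m: "\<not> ?d m"
    using assms padic_int_eq_0_iff by blast
  have bound: "j \<le> m" if "?d j" for j
    using that m by (metis dvd_trans le_imp_power_dvd nat_le_linear)
  have "?d (padic_val x)"
    unfolding padic_val_def by (rule GreatestI_nat[of ?d 0 m]) (auto intro: bound)
  moreover have "j \<le> padic_val x" if "?d j" for j
    unfolding padic_val_def by (rule Greatest_le_nat[of ?d j m]) (auto intro: bound that)
  ultimately show ?thesis
    by (meson dvd_trans le_imp_power_dvd)
qed

instantiation padic_int :: (card2) metric_space
begin

definition dist_padic_int :: "'a padic_int \<Rightarrow> 'a padic_int \<Rightarrow> real"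
  where "dist x y = (if x = y then 0 else 1 / real CARD('a) ^ padic_val (x - y))"

definition uniformity_padic_int :: "('a padic_int \<times> 'a padic_int) filter"
  where "uniformity_padic_int = (INF e\<in>{0 <..}. principal {(x, y). dist x y < e})"

definition open_padic_int :: "'a padic_int set \<Rightarrow> bool"
  where "open_padic_int U \<longleftrightarrow> (\<forall>x\<in>U. \<forall>\<^sub>F (x', y) in uniformity. x' = x \<longrightarrow> y \<in> U)"

lemma dist_padic_int_le_iff:
  fixes x y :: "'a padic_int"
  shows "dist x y \<le> 1 / real CARD('a) ^ k \<longleftrightarrow> of_nat CARD('a) ^ k dvd x - y"
proof (cases "x = y")
  case False
  have "real CARD('a) > 1"
    using two_le_card[where 'a='a] by linarith
  then have "dist x y \<le> 1 / real CARD('a) ^ k \<longleftrightarrow> k \<le> padic_val (x - y)"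
    using False by (simp add: dist_padic_int_def field_simps power_increasing_iff)
  then show ?thesis
    using power_CARD_dvd_iff_le_val[of "x - y" k] False by simp
qed (simp add: dist_padic_int_def)

instance
proof
  fix x y z :: "'a padic_int"
  show "dist x y = 0 \<longleftrightarrow> x = y"
    by (simp add: dist_padic_int_def)
  show "dist x y \<le> dist x z + dist y z"
  proof (cases "x = z \<or> y = z")
    case True
    have "of_nat CARD('a) ^ k dvd y - x \<longleftrightarrow> of_nat CARD('a) ^ k dvd x - y" for k
      using dvd_minus_iff[of _ "x - y"] by simp
    then have "padic_val (y - x) = padic_val (x - y)"
      by (simp only: padic_val_def)
    with True show ?thesis
      by (auto simp: dist_padic_int_def)
  next
    case False
    define k where "k = min (padic_val (x - z)) (padic_val (y - z))"
    have "of_nat CARD('a) ^ k dvd x - z" "of_nat CARD('a) ^ k dvd y - z"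
      using False power_CARD_dvd_iff_le_val[of "x - z" k] power_CARD_dvd_iff_le_val[of "y - z" k]
      by (auto simp: k_def)
    then have "of_nat CARD('a) ^ k dvd (x - z) - (y - z)"
      by (rule dvd_diff)
    then have "dist x y \<le> 1 / real CARD('a) ^ k"
      by (simp add: dist_padic_int_le_iff)
    also have "\<dots> \<le> dist x z + dist y z"
      using False by (auto simp: k_def dist_padic_int_def min_def)
    finally show ?thesis .
  qed
qed (simp_all only: uniformity_padic_int_def open_padic_int_def)

end


section \<open>Automorphisms\<close>

definition padic_cong :: "nat \<Rightarrow> 'p::card2 padic_int \<Rightarrow> 'p padic_int \<Rightarrow> bool"
  where "padic_cong k x y \<longleftrightarrow> of_nat CARD('p) ^ k dvd x - y"

definition padic_automorphism ::
    "('p::card2 padic_int \<Rightarrow> 'p padic_int \<Rightarrow> 'p padic_int) \<Rightarrow> ('p padic_int \<Rightarrow> 'p padic_int) \<Rightarrow> bool"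
  where "padic_automorphism G f \<longleftrightarrow>
    bij f \<and>
    (\<forall>x y. f (x + y) = f x + f y) \<and>
    (\<forall>x y. f (G x y) = G (f x) (f y)) \<and>
    (\<forall>k\<ge>1. \<forall>x y. padic_cong k x y \<longrightarrow> padic_cong k (f x) (f y))"

definition padic_Aut ::
    "('p::card2 padic_int \<Rightarrow> 'p padic_int \<Rightarrow> 'p padic_int) \<Rightarrow> ('p padic_int \<Rightarrow> 'p padic_int) monoid"
  where "padic_Aut G = \<lparr>carrier = {f. padic_automorphism G f}, monoid.mult = (\<circ>), one = id\<rparr>"

lemma padic_automorphism_id: "padic_automorphism G id"
  by (simp add: padic_automorphism_def)

lemma padic_automorphism_comp:
  "padic_automorphism G f \<Longrightarrow> padic_automorphism G g \<Longrightarrow> padic_automorphism G (f \<circ> g)"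
  by (simp add: padic_automorphism_def bij_comp)

lemma padic_automorphism_inv:
  fixes f :: "'p::card2 padic_int \<Rightarrow> 'p padic_int"
  assumes "padic_automorphism G f"
  shows "padic_automorphism G (inv_into UNIV f)"
proof -
  let ?g = "inv_into UNIV f"
  have bij: "bij f" and add: "\<And>x y. f (x + y) = f x + f y"
    and G: "\<And>x y. f (G x y) = G (f x) (f y)"
    using assms by (auto simp: padic_automorphism_def)
  have inv: "f (?g x) = x" "?g (f x) = x" for x
    using bij by (simp_all add: bij_is_surj surj_f_inv_f bij_is_inj)
  have of_nat: "f (of_nat n * x) = of_nat n * f x" for n x
  proof (induction n)
    case 0
    show ?case using add[of 0 0] by simp
  next
    case (Suc n)
    then show ?case by (simp add: distrib_right add)
  qed
  have add': "?g (x + y) = ?g x + ?g y" for x y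
    by (metis add inv)
  have "padic_cong k (?g x) (?g y)" if cong: "padic_cong k x y" for k x y
  proof -
    obtain z where "x - y = of_nat (CARD('p) ^ k) * z"
      using cong by (auto simp: padic_cong_def dvd_def)
    also have "\<dots> = f (of_nat (CARD('p) ^ k) * ?g z)"
      by (simp only: of_nat inv)
    finally have "?g (x - y) = of_nat (CARD('p) ^ k) * ?g z"
      by (simp only: inv)
    then have "?g x - ?g y = of_nat (CARD('p) ^ k) * ?g z"
      using add'[of "x - y" y] by simp
    then show ?thesis
      by (simp add: padic_cong_def)
  qed
  moreover have "?g (G x y) = G (?g x) (?g y)" for x y
    by (metis G inv)
  ultimately show ?thesis
    using bij add' by (simp add: padic_automorphism_def bij_imp_bij_inv)
qed

lemma group_padic_Aut: "group (padic_Aut G)"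
proof (rule groupI)
  fix f assume "f \<in> carrier (padic_Aut G)"
  then have f: "padic_automorphism G f"
    by (simp add: padic_Aut_def)
  then have "inv_into UNIV f \<circ> f = id"
    by (simp add: padic_automorphism_def bij_is_inj)
  with f show "\<exists>g\<in>carrier (padic_Aut G). g \<otimes>\<^bsub>padic_Aut G\<^esub> f = \<one>\<^bsub>padic_Aut G\<^esub>"
    using padic_automorphism_inv by (auto simp: padic_Aut_def)
qed (auto simp: padic_Aut_def padic_automorphism_id padic_automorphism_comp comp_assoc)

lemma trivial_group_padic_Aut_iff:
  "trivial_group (padic_Aut G) \<longleftrightarrow> (\<forall>f. padic_automorphism G f \<longrightarrow> f = id)"
  using padic_automorphism_id[of G] group_padic_Aut[of G]
  by (auto simp: trivial_group_def padic_Aut_def)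


section \<open>The degree set of a series\<close>

text \<open>
  The terms of total degree at most 1 of a series are given separately, so the values \<open>C i j\<close> with
  \<open>i + j \<le> 1\<close> play no role.
\<close>

definition degree_set :: "(nat \<Rightarrow> nat \<Rightarrow> 'a::zero) \<Rightarrow> nat set"
  where "degree_set C = {n. n > 1 \<and> (\<exists>i j. i + j = n \<and> C i j \<noteq> 0)}"

definition homogeneous_part :: "(nat \<Rightarrow> nat \<Rightarrow> 'a::comm_ring_1) \<Rightarrow> nat \<Rightarrow> 'a \<Rightarrow> 'a \<Rightarrow> 'a"
  where "homogeneous_part C n x y = (\<Sum>(i, j) | i + j = n. C i j * x ^ i * y ^ j)"

end

theory Submission
  imports Defs "HOL-Number_Theory.Residue_Primitive_Roots"
begin

text \<open>
  An additive map that preserves all congruences modulo \<open>p\<^sup>k\<close> is multiplication by \<open>u = f 1\<close>, because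
  every \<open>p\<close>-adic integer is congruent to a natural number modulo \<open>p\<^sup>k\<close> and additivity settles natural
  numbers (\<open>padic_linear_if_additive_and_congruence_preserving\<close>). Bijectivity makes \<open>u\<close> a unit, so the
  automorphisms are the units \<open>u\<close> with \<open>u G(x, y) = G(u x, u y)\<close>. The right side multiplies the
  homogeneous part of degree \<open>n\<close> by \<open>u\<^sup>n\<close>, the left side multiplies it by \<open>u\<close>. Replacing \<open>(x, y)\<close> by
  \<open>(t x, t y)\<close> turns the difference of the two sides into a power series in \<open>t\<close> that vanishes for all
  \<open>t\<close>, and such a series has zero coefficients (\<open>padic_power_series_eq_0\<close>). Hence \<open>u\<close> gives an
  automorphism exactly when \<open>(u - 1) c = 0\<close> and \<open>u\<^bsup>n-1\<^esup> = 1\<close> for all \<open>n\<close> in the degree set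
  (\<open>scaling_commutes_with_series_iff\<close>); the linear terms commute with every \<open>u\<close>.

  If the degree set is empty, only \<open>c = 0\<close> is left as a condition, and \<open>u = -1\<close> is then a nontrivial
  automorphism. Otherwise the question is whether the exponents \<open>n - 1\<close> admit a common root of unity
  other than 1, and the answer comes from the structure of the roots of unity of the \<open>p\<close>-adic integers
  (\<open>common_root_of_unity_iff\<close>). For odd \<open>p\<close> no root of unity except 1 is congruent to 1 modulo \<open>p\<close>,
  while by Teichmueller's construction every root of unity modulo \<open>p\<close> lifts; so a root \<open>x \<noteq> 1\<close> of
  \<open>x\<^sup>d = 1\<close> exists precisely when the part of \<open>d\<close> prime to \<open>p\<close> has a common factor with \<open>p - 1\<close>.
  For \<open>p = 2\<close> there is no root of unity \<open>x \<noteq> 1\<close> of odd exponent, and \<open>x = -1\<close> serves all even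
  exponents.
\<close>

section \<open>Divisibility and congruences\<close>

lemma diff_dvd_power_diff:
  fixes x y :: "'a::comm_ring_1"
  shows "x - y dvd x ^ n - y ^ n"
  by (simp add: power_diff_sumr2)

lemma diff_one_dvd_power_diff_one:
  fixes x :: "'a::comm_ring_1"
  shows "x - 1 dvd x ^ n - 1"
  using diff_dvd_power_diff[of x 1 n] by simp

text \<open>
  Raising to the power \<open>q\<close> sharpens a congruence by one factor \<open>q\<close>: in
  \<open>X\<^sup>q - Y\<^sup>q = (X - Y) (\<Sum>i<q. Y\<^bsup>q-1-i\<^esup> X\<^sup>i)\<close> each of the \<open>q\<close> summands is congruent to \<open>Y\<^bsup>q-1\<^esup>\<close>
  modulo \<open>q\<close>, so the sum is divisible by \<open>q\<close>. This makes the sequence \<open>a ^ (p ^ k)\<close> converge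
  \<open>p\<close>-adically.
\<close>

lemma power_dvd_power_power_diff:
  fixes x y :: "'a::comm_ring_1"
  assumes "of_nat q dvd x - y"
  shows "of_nat q ^ Suc k dvd x ^ (q ^ k) - y ^ (q ^ k)"
proof (induction k)
  case 0
  then show ?case using assms by simp
next
  case (Suc k)
  define X Y where "X = x ^ (q ^ k)" and "Y = y ^ (q ^ k)"
  have XY: "of_nat q dvd X - Y"
    using assms diff_dvd_power_diff[of x y "q ^ k"] unfolding X_def Y_def by (rule dvd_trans)
  have "of_nat q dvd (\<Sum>i<q. Y ^ (q - Suc i) * X ^ i - Y ^ (q - 1))"
  proof (rule dvd_sum)
    fix i assume "i \<in> {..<q}"
    then have "q - 1 = q - Suc i + i"
      by simp
    then have "Y ^ (q - Suc i) * X ^ i - Y ^ (q - 1) = Y ^ (q - Suc i) * (X ^ i - Y ^ i)"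
      by (simp only: power_add right_diff_distrib)
    then show "of_nat q dvd Y ^ (q - Suc i) * X ^ i - Y ^ (q - 1)"
      using XY diff_dvd_power_diff[of X Y i] dvd_trans by fastforce
  qed
  also have "(\<Sum>i<q. Y ^ (q - Suc i) * X ^ i - Y ^ (q - 1))
      = (\<Sum>i<q. Y ^ (q - Suc i) * X ^ i) - of_nat q * Y ^ (q - 1)"
    by (simp add: sum_subtractf)
  finally have "of_nat q dvd (\<Sum>i<q. Y ^ (q - Suc i) * X ^ i)"
    by (metis diff_add_cancel dvd_add dvd_triv_left)
  with Suc have "of_nat q ^ Suc k * of_nat q dvd (X - Y) * (\<Sum>i<q. Y ^ (q - Suc i) * X ^ i)"
    unfolding X_def Y_def by (rule mult_dvd_mono)
  then show ?case
    unfolding power_diff_sumr2[symmetric] X_def Y_def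
    by (simp add: mult_ac flip: power_mult)
qed

section \<open>The ring of p-adic integers\<close>

lemma residue_power: "residue (x ^ n :: 'p::card2 padic_int) k = residue x k ^ n mod int CARD('p) ^ k"
  by (induction n) (simp_all add: residue_simps mod_simps)

lemma of_nat_CARD_dvd_iff: "of_nat CARD('p) dvd (x :: 'p::card2 padic_int) \<longleftrightarrow> residue x 1 = 0"
  using power_CARD_dvd_iff[of 1 x] by simp

lemma power_CARD_dvd_of_nat_iff:
  "of_nat CARD('p) ^ k dvd (of_nat m :: 'p::card2 padic_int) \<longleftrightarrow> CARD('p) ^ k dvd m"
proof -
  have "of_nat CARD('p) ^ k dvd (of_nat m :: 'p padic_int) \<longleftrightarrow> int (CARD('p) ^ k) dvd int m"
    by (simp add: power_CARD_dvd_iff residue_of_nat mod_eq_0_iff_dvd)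
  then show ?thesis
    by (simp only: int_dvd_int_iff)
qed

lemma nat_approx:
  fixes x :: "'p::card2 padic_int"
  obtains m where "of_nat CARD('p) ^ k dvd x - of_nat m"
proof
  have "residue x k \<ge> 0"
    by (metis residue_mod pos_mod_sign of_nat_0_less_iff zero_less_card_finite zero_less_power)
  then have "residue (of_nat (nat (residue x k)) :: 'p padic_int) k = residue x k"
    by (simp only: residue_of_nat int_nat_eq if_True residue_mod)
  then show "of_nat CARD('p) ^ k dvd x - of_nat (nat (residue x k))"
    by (simp add: power_CARD_dvd_iff residue_simps)
qed

lemma prime_CARD_dvd_mult:
  fixes x y :: "'p::card2 padic_int"
  assumes "prime CARD('p)" and "of_nat CARD('p) dvd x * y"
  shows "of_nat CARD('p) dvd x \<or> of_nat CARD('p) dvd y"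
proof -
  have "int CARD('p) dvd residue x 1 * residue y 1"
    using assms(2) by (simp add: of_nat_CARD_dvd_iff residue_simps mod_eq_0_iff_dvd)
  then have "int CARD('p) dvd residue x 1 \<or> int CARD('p) dvd residue y 1"
    using assms(1) by (simp add: prime_dvd_mult_iff)
  then show ?thesis
    using residue_mod[of x 1] residue_mod[of y 1]
    by (auto simp: of_nat_CARD_dvd_iff simp del: residue_mod)
qed

text \<open>
  Multiplication by the base shifts the components by one place, so that component \<open>k\<close> of \<open>x\<close> is
  determined by component \<open>k + 1\<close> of the product.
\<close>

lemma CARD_mult_eq_0:
  fixes x :: "'p::card2 padic_int"
  assumes "of_nat CARD('p) * x = 0"
  shows "x = 0"
proof (rule padic_int_eqI)
  fix k
  have "int CARD('p) * residue x (Suc k) mod int CARD('p) ^ Suc k = 0"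
    using arg_cong[OF assms, of "\<lambda>z. residue z (Suc k)"]
    by (simp add: residue_simps residue_of_nat mod_simps)
  then have "int CARD('p) * int CARD('p) ^ k dvd int CARD('p) * residue x (Suc k)"
    by (simp add: mod_eq_0_iff_dvd)
  then have "residue x (Suc k) mod int CARD('p) ^ k = 0"
    by (simp add: mod_eq_0_iff_dvd)
  then show "residue x k = residue 0 k"
    by (simp add: residue_Suc_mod residue_simps)
qed

lemma minus_one_neq_one: "(-1 :: 'p::card2 padic_int) \<noteq> 1"
proof
  assume "(-1 :: 'p padic_int) = 1"
  then have "of_nat 2 = (0 :: 'p padic_int)"
    by (metis add.right_inverse one_add_one of_nat_numeral)
  then have "CARD('p) ^ 2 dvd 2"
    using power_CARD_dvd_of_nat_iff[where 'p='p, of 2 2] by simp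
  then have "CARD('p) ^ 2 \<le> 2"
    by (rule dvd_imp_le) simp
  moreover have "2 ^ 2 \<le> CARD('p) ^ 2"
    using two_le_card by (rule power_mono) simp
  ultimately show False by simp
qed

lemma CARD_power_mult_eq_0:
  fixes x :: "'p::card2 padic_int"
  shows "of_nat CARD('p) ^ k * x = 0 \<Longrightarrow> x = 0"
proof (induction k)
  case (Suc k)
  then show ?case
    using CARD_mult_eq_0[of "of_nat CARD('p) ^ k * x"] by (simp add: mult.assoc)
qed simp

lemma CARD_power_mult_dvd_cancel:
  fixes x :: "'p::card2 padic_int"
  assumes "of_nat CARD('p) ^ (k + l) dvd of_nat CARD('p) ^ k * x"
  shows "of_nat CARD('p) ^ l dvd x"
proof -
  obtain z where "of_nat CARD('p) ^ k * x = of_nat CARD('p) ^ (k + l) * z"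
    using assms by (auto simp: dvd_def)
  then have "of_nat CARD('p) ^ k * (x - of_nat CARD('p) ^ l * z) = 0"
    by (simp add: algebra_simps power_add)
  then have "x = of_nat CARD('p) ^ l * z"
    using CARD_power_mult_eq_0 by fastforce
  then show ?thesis by simp
qed

lemma CARD_power_factor:
  fixes x :: "'p::card2 padic_int"
  assumes "x \<noteq> 0"
  obtains k u where "x = of_nat CARD('p) ^ k * u" and "\<not> of_nat CARD('p) dvd u"
proof -
  obtain u where u: "x = of_nat CARD('p) ^ padic_val x * u"
    using power_CARD_dvd_iff_le_val[OF assms, of "padic_val x"] by (auto simp: dvd_def)
  have "\<not> of_nat CARD('p) dvd u"
  proof
    assume "of_nat CARD('p) dvd u"
    then have "of_nat CARD('p) ^ padic_val x * of_nat CARD('p) dvd x"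
      by (subst u) (rule mult_dvd_mono, simp_all)
    then have "of_nat CARD('p) ^ Suc (padic_val x) dvd x"
      by (simp only: power_Suc2)
    then show False
      using power_CARD_dvd_iff_le_val[OF assms, of "Suc (padic_val x)"] by simp
  qed
  with u show ?thesis by (rule that)
qed

text \<open>
  After splitting off the exact powers of \<open>p\<close>, the remaining factors are nonzero modulo the prime \<open>p\<close>,
  hence so is their product, and powers of \<open>p\<close> are not zero divisors.
\<close>

lemma padic_int_no_zero_divisors:
  fixes x y :: "'p::card2 padic_int"
  assumes p: "prime CARD('p)" and xy: "x * y = 0"
  shows "x = 0 \<or> y = 0"
proof (rule ccontr)
  assume "\<not> (x = 0 \<or> y = 0)"
  then obtain k u l v where u: "x = of_nat CARD('p) ^ k * u" "\<not> of_nat CARD('p) dvd u"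
    and v: "y = of_nat CARD('p) ^ l * v" "\<not> of_nat CARD('p) dvd v"
    using CARD_power_factor[of x] CARD_power_factor[of y] by metis
  have "of_nat CARD('p) ^ (k + l) * (u * v) = 0"
    using xy u(1) v(1) by (simp add: power_add mult_ac)
  then have "u * v = 0"
    by (rule CARD_power_mult_eq_0)
  then have "of_nat CARD('p) dvd u * v"
    by simp
  with prime_CARD_dvd_mult[OF p] u(2) v(2) show False by blast
qed

section \<open>Roots of unity\<close>

lemma padic_fermat:
  fixes x :: "'p::card2 padic_int"
  assumes p: "prime CARD('p)" and "\<not> of_nat CARD('p) dvd x"
  shows "of_nat CARD('p) dvd x ^ (CARD('p) - 1) - 1"
proof -
  obtain m where m: "of_nat CARD('p) dvd x - of_nat m"
    using nat_approx[where x = x and k = 1] by auto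
  have "\<not> CARD('p) dvd m"
  proof
    assume "CARD('p) dvd m"
    then have "of_nat CARD('p) dvd (of_nat m :: 'p padic_int)"
      by auto
    then have "of_nat CARD('p) dvd (x - of_nat m) + of_nat m"
      using m by (rule dvd_add[rotated])
    with assms(2) show False by simp
  qed
  with p have "[m ^ (CARD('p) - 1) = 1] (mod CARD('p))"
    by (rule fermat_theorem)
  then have "[int (m ^ (CARD('p) - 1)) = int 1] (mod int CARD('p))"
    by (simp only: cong_int_iff)
  then have "of_nat CARD('p) dvd (of_nat m ^ (CARD('p) - 1) - 1 :: 'p padic_int)"
    by (simp add: of_nat_CARD_dvd_iff residue_simps residue_of_nat residue_power cong_iff_dvd_diff
        mod_simps mod_eq_0_iff_dvd)
  moreover have "of_nat CARD('p) dvd x ^ (CARD('p) - 1) - of_nat m ^ (CARD('p) - 1)"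
    using m diff_dvd_power_diff dvd_trans by blast
  ultimately have "of_nat CARD('p) dvd
      (x ^ (CARD('p) - 1) - of_nat m ^ (CARD('p) - 1)) + (of_nat m ^ (CARD('p) - 1) - 1)"
    by (simp only: dvd_add)
  then show ?thesis by simp
qed

lemma padic_fermat_power:
  fixes x :: "'p::card2 padic_int"
  assumes p: "prime CARD('p)"
  shows "of_nat CARD('p) dvd x ^ (CARD('p) ^ s) - x"
proof (induction s)
  case (Suc s)
  have *: "of_nat CARD('p) dvd y ^ CARD('p) - y" for y :: "'p padic_int"
  proof -
    have "y ^ CARD('p) = y * y ^ (CARD('p) - 1)"
      using p by (metis power_minus_mult mult.commute prime_gt_0_nat)
    then have "y ^ CARD('p) - y = y * (y ^ (CARD('p) - 1) - 1)"
      by (simp only: right_diff_distrib mult_1_right)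
    then show ?thesis
      using padic_fermat[OF p, of y] by (cases "of_nat CARD('p) dvd y") simp_all
  qed
  have "x ^ (CARD('p) ^ Suc s) - x
      = ((x ^ (CARD('p) ^ s)) ^ CARD('p) - x ^ (CARD('p) ^ s)) + (x ^ (CARD('p) ^ s) - x)"
    by (simp add: mult.commute flip: power_mult)
  then show ?case
    using * Suc dvd_add by metis
qed simp

text \<open>
  In a domain, \<open>x\<^sup>n - 1 = (x - 1) (1 + x + \<dots> + x\<^bsup>n-1\<^esup>)\<close> leaves only \<open>x = 1\<close> unless the second factor
  vanishes. The two lemmas on roots congruent to 1 modulo \<open>p\<close> show that it does not by computing it
  modulo a small power of \<open>p\<close>.
\<close>

lemma root_of_unity_eq_1_if_geometric_sum:
  fixes x :: "'p::card2 padic_int"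
  assumes p: "prime CARD('p)" and "x ^ n = 1" and "(\<Sum>i<n. x ^ i) \<noteq> 0"
  shows "x = 1"
proof -
  have "(x - 1) * (\<Sum>i<n. x ^ i) = 0"
    using assms(2) by (simp flip: power_diff_1_eq)
  then show ?thesis
    using padic_int_no_zero_divisors[OF p] assms(3) by fastforce
qed

text \<open>
  Modulo \<open>p\<close> every summand of the geometric sum is 1, so the sum is \<open>n\<close>, which is not 0.
\<close>

lemma coprime_root_of_unity_cong_1:
  fixes x :: "'p::card2 padic_int"
  assumes p: "prime CARD('p)" and x: "of_nat CARD('p) dvd x - 1" and "x ^ n = 1"
    and n: "\<not> CARD('p) dvd n"
  shows "x = 1"
  using p \<open>x ^ n = 1\<close>
proof (rule root_of_unity_eq_1_if_geometric_sum)
  have "of_nat CARD('p) dvd (\<Sum>i<n. x ^ i - 1)"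
    using x diff_one_dvd_power_diff_one dvd_trans by (intro dvd_sum) blast
  then have "of_nat CARD('p) dvd (\<Sum>i<n. x ^ i) - of_nat n"
    by (simp add: sum_subtractf)
  moreover have "\<not> of_nat CARD('p) dvd (of_nat n :: 'p padic_int)"
    using n power_CARD_dvd_of_nat_iff[where 'p='p, of 1 n] by simp
  ultimately show "(\<Sum>i<n. x ^ i) \<noteq> 0"
    by auto
qed

lemma one_plus_power_second_order:
  fixes y :: "'a::comm_ring_1"
  shows "y\<^sup>2 dvd (1 + y) ^ i - (1 + of_nat i * y)"
proof (induction i)
  case (Suc i)
  have "(1 + y) ^ Suc i - (1 + of_nat (Suc i) * y)
      = (1 + y) * ((1 + y) ^ i - (1 + of_nat i * y)) + of_nat i * y\<^sup>2"
    by (simp add: algebra_simps power2_eq_square)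
  then show ?case
    using Suc by (metis dvd_add dvd_mult dvd_triv_right)
qed simp

text \<open>
  For the exponent \<open>p\<close> the geometric sum is 0 modulo \<open>p\<close>, so it is computed modulo \<open>p\<^sup>2\<close>. With \<open>x = 1 + y\<close> it is
  \<open>\<Sum>i<p. (1 + i y) = p + y p (p - 1) / 2\<close>. For odd \<open>p\<close> the last term is divisible by \<open>p\<^sup>2\<close>, which
  leaves \<open>p \<noteq> 0\<close>. For \<open>p = 2\<close> the claim fails: \<open>-1\<close> is congruent to 1.
\<close>

lemma prime_root_of_unity_cong_1:
  fixes x :: "'p::card2 padic_int"
  assumes p: "prime CARD('p)" and "CARD('p) \<noteq> 2" and x: "of_nat CARD('p) dvd x - 1"
    and "x ^ CARD('p) = 1"
  shows "x = 1"
  using p \<open>x ^ CARD('p) = 1\<close>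
proof (rule root_of_unity_eq_1_if_geometric_sum)
  let ?p = "of_nat CARD('p) :: 'p padic_int"
  have "odd CARD('p)"
    using p assms(2) by (metis prime_nat_iff two_is_prime_nat primes_dvd_imp_eq)
  then obtain h where h: "CARD('p) = 2 * h + 1"
    by (rule oddE)
  have "(\<Sum>i<CARD('p). i) = CARD('p) * h"
    unfolding h by (induction h) auto
  then have tri: "(\<Sum>i<CARD('p). of_nat i) = ?p * of_nat h"
    by (simp flip: of_nat_sum of_nat_mult)
  have sq: "?p\<^sup>2 dvd (x - 1)\<^sup>2"
    using x by (rule dvd_power_same)
  have "?p\<^sup>2 dvd (\<Sum>i<CARD('p). x ^ i - (1 + of_nat i * (x - 1)))"
    using dvd_trans[OF sq one_plus_power_second_order[of "x - 1"]] by (intro dvd_sum) simp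
  also have "\<dots> = (\<Sum>i<CARD('p). x ^ i) - (?p + ?p * of_nat h * (x - 1))"
    by (simp add: sum_subtractf sum.distrib flip: sum_distrib_right tri)
  finally have "?p\<^sup>2 dvd (\<Sum>i<CARD('p). x ^ i) - (?p + ?p * of_nat h * (x - 1))" .
  moreover have "?p\<^sup>2 dvd ?p * of_nat h * (x - 1)"
    using x by (simp add: power2_eq_square mult_dvd_mono)
  ultimately have "?p\<^sup>2 dvd (\<Sum>i<CARD('p). x ^ i) - (?p + ?p * of_nat h * (x - 1)) + ?p * of_nat h * (x - 1)"
    by (rule dvd_add)
  then have *: "?p\<^sup>2 dvd (\<Sum>i<CARD('p). x ^ i) - ?p"
    by (simp add: algebra_simps)
  have "\<not> ?p\<^sup>2 dvd ?p"
    using power_CARD_dvd_of_nat_iff[where 'p='p, of 2 "CARD('p)"] prime_gt_1_nat[OF p]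
    by (simp add: power2_eq_square)
  with * show "(\<Sum>i<CARD('p). x ^ i) \<noteq> 0"
    by auto
qed

text \<open>
  The group \<open>1 + p\<int>\<^sub>p\<close> is torsion-free for odd \<open>p\<close>.
\<close>

lemma root_of_unity_cong_1:
  fixes x :: "'p::card2 padic_int"
  assumes p: "prime CARD('p)" and p2: "CARD('p) \<noteq> 2"
    and n: "\<not> CARD('p) dvd n"
  shows "of_nat CARD('p) dvd x - 1 \<Longrightarrow> x ^ (CARD('p) ^ s * n) = 1 \<Longrightarrow> x = 1"
proof (induction s arbitrary: x)
  case 0
  then show ?case
    using coprime_root_of_unity_cong_1[OF p _ _ n] by simp
next
  case (Suc s)
  have "x ^ CARD('p) = 1"
  proof (rule Suc.IH)
    show "of_nat CARD('p) dvd x ^ CARD('p) - 1"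
      using Suc.prems(1) diff_one_dvd_power_diff_one by (rule dvd_trans)
    show "(x ^ CARD('p)) ^ (CARD('p) ^ s * n) = 1"
      using Suc.prems(2) by (simp only: power_Suc mult.assoc power_mult)
  qed
  then show ?case
    using prime_root_of_unity_cong_1[OF p p2] Suc.prems(1) by blast
qed

text \<open>
  Raising to the power \<open>p\<^sup>s\<close> does nothing modulo \<open>p\<close>, so \<open>x\<^sup>n\<close> is congruent to 1, as is \<open>x\<^bsup>p-1\<^esup>\<close>. If
  \<open>n\<close> and \<open>p - 1\<close> were coprime, \<open>x\<close> itself would be congruent to 1 and hence equal to 1.
\<close>

lemma root_of_unity_exponent_not_coprime:
  fixes x :: "'p::card2 padic_int"
  assumes p: "prime CARD('p)" and p2: "CARD('p) \<noteq> 2"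
    and n: "\<not> CARD('p) dvd n" and x: "x ^ (CARD('p) ^ s * n) = 1" and "x \<noteq> 1"
  shows "gcd n (CARD('p) - 1) \<noteq> 1"
proof
  let ?p = "of_nat CARD('p) :: 'p padic_int"
  assume gcd: "gcd n (CARD('p) - 1) = 1"
  have "n \<noteq> 0"
    using n by (metis dvd_0_right)
  \<comment> \<open>A Bezout identity expresses \<open>x\<close> modulo \<open>p\<close> by powers of \<open>x ^ n\<close> and \<open>x ^ (p - 1)\<close>.\<close>
  then obtain u v where uv: "n * u = (CARD('p) - 1) * v + 1"
    using bezout_nat[of n "CARD('p) - 1"] gcd by auto
  have "?p dvd (x ^ n) ^ (CARD('p) ^ s) - x ^ n"
    by (rule padic_fermat_power[OF p])
  then have "?p dvd 1 - x ^ n"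
    using x by (simp add: mult.commute flip: power_mult)
  then have xn: "?p dvd x ^ n - 1"
    by (subst (asm) dvd_minus_iff[symmetric]) simp
  have "\<not> ?p dvd x"
  proof
    assume "?p dvd x"
    then have "?p dvd x ^ n"
      using \<open>n \<noteq> 0\<close> by (metis dvd_power dvd_trans gr0I)
    with xn have "?p dvd x ^ n - (x ^ n - 1)"
      by (rule dvd_diff[rotated])
    then show False
      using prime_gt_1_nat[OF p] power_CARD_dvd_of_nat_iff[where 'p='p, of 1 1] by simp
  qed
  then have "?p dvd x ^ (CARD('p) - 1) - 1"
    by (rule padic_fermat[OF p])
  then have 1: "?p dvd x ^ ((CARD('p) - 1) * v) - 1"
    unfolding power_mult using diff_one_dvd_power_diff_one dvd_trans by blast
  have 2: "?p dvd x ^ (n * u) - 1"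
    unfolding power_mult using xn diff_one_dvd_power_diff_one dvd_trans by blast
  have "x - 1 = (x ^ (n * u) - 1) - x * (x ^ ((CARD('p) - 1) * v) - 1)"
    unfolding uv by (simp add: power_add algebra_simps)
  then have "?p dvd x - 1"
    using 1 2 by (metis dvd_diff dvd_mult)
  then have "x = 1"
    using root_of_unity_cong_1[OF p p2 n] x by blast
  with \<open>x \<noteq> 1\<close> show False ..
qed

text \<open>
  The root is the Teichmueller lift \<open>lim a ^ (p ^ k)\<close> of \<open>a\<close>. Since \<open>a ^ (p ^ k)\<close> already agrees with
  the limit modulo \<open>p ^ k\<close>, its residues give the components of the limit directly. The lift inherits
  \<open>x\<^sup>m = 1\<close> because \<open>(a\<^sup>m) ^ (p ^ k)\<close> tends to 1, and it stays congruent to \<open>a\<close> modulo \<open>p\<close>.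
\<close>

lemma teichmueller_root_of_unity:
  assumes p: "prime CARD('p::card2)" and a: "[int a ^ m = 1] (mod int CARD('p))"
    and "\<not> [a = 1] (mod CARD('p))"
  shows "\<exists>x :: 'p padic_int. x \<noteq> 1 \<and> x ^ m = 1"
proof -
  let ?p = "int CARD('p)"
  define f where "f k = int a ^ (CARD('p) ^ k) mod ?p ^ k" for k
  have fermat: "[a ^ CARD('p) = a] (mod CARD('p))"
  proof (cases "CARD('p) dvd a")
    case True
    then show ?thesis
      using p by (auto simp: cong_def mod_eq_0_iff_dvd dvd_power prime_gt_0_nat intro: dvd_trans)
  next
    case False
    have "a ^ CARD('p) = a ^ (CARD('p) - 1) * a"
      using p by (metis power_minus_mult prime_gt_0_nat)
    with cong_mult[OF fermat_theorem[OF p False] cong_refl[of a]] show ?thesis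
      by simp
  qed
  then have "?p dvd int a ^ CARD('p) - int a"
    by (metis cong_iff_dvd_diff cong_int_iff of_nat_power)
  then have "?p ^ Suc k dvd (int a ^ CARD('p)) ^ (CARD('p) ^ k) - int a ^ (CARD('p) ^ k)" for k
    using power_dvd_power_power_diff[of "CARD('p)" "int a ^ CARD('p)" "int a" k] by simp
  then have "?p ^ k dvd int a ^ (CARD('p) ^ Suc k) - int a ^ (CARD('p) ^ k)" for k
    by (metis dvd_trans le_imp_power_dvd le_SucI order_refl power_Suc power_mult)
  then have "int a ^ (CARD('p) ^ Suc k) mod ?p ^ k = int a ^ (CARD('p) ^ k) mod ?p ^ k" for k
    by (simp only: mod_eq_dvd_iff)
  then have "f k = f (Suc k) mod ?p ^ k" for k
    unfolding f_def mod_power_Suc_mod by simp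
  then have rep: "residue (Abs_padic_int f :: 'p padic_int) = f"
    by (intro Abs_padic_int_inverse CollectI allI)
  have "(Abs_padic_int f :: 'p padic_int) ^ m = 1"
  proof (rule padic_int_eqI)
    fix k
    have "?p dvd int a ^ m - 1"
      using a by (simp add: cong_iff_dvd_diff)
    then have "?p ^ Suc k dvd (int a ^ m) ^ (CARD('p) ^ k) - 1 ^ (CARD('p) ^ k)"
      using power_dvd_power_power_diff[of "CARD('p)" "int a ^ m" 1 k] by simp
    then have "?p ^ k dvd (int a ^ (CARD('p) ^ k)) ^ m - 1"
      by (metis dvd_trans le_imp_power_dvd le_SucI order_refl power_mult mult.commute power_one)
    then show "residue (Abs_padic_int f ^ m :: 'p padic_int) k = residue (1 :: 'p padic_int) k"
      by (simp add: residue_power rep f_def residue_simps mod_simps mod_eq_dvd_iff)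
  qed
  moreover have "Abs_padic_int f \<noteq> (1 :: 'p padic_int)"
  proof
    assume "Abs_padic_int f = (1 :: 'p padic_int)"
    then have "f 1 = residue (1 :: 'p padic_int) 1"
      using rep by simp
    then have "[int (a ^ CARD('p)) = int 1] (mod ?p)"
      by (simp add: f_def residue_simps cong_def)
    then have "[a ^ CARD('p) = 1] (mod CARD('p))"
      by (simp only: cong_int_iff)
    with fermat assms(3) show False
      using cong_sym cong_trans by blast
  qed
  ultimately show ?thesis by blast
qed

text \<open>
  For a primitive root \<open>g\<close> modulo \<open>p\<close> and \<open>m = gcd n (p - 1) > 1\<close>, the power \<open>g ^ ((p - 1) / m)\<close>
  has order \<open>m\<close> modulo \<open>p\<close>. Its Teichmueller lift is the required root.
\<close>

lemma exists_nontrivial_root_of_unity: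
  assumes p: "prime CARD('p::card2)" and n: "gcd n (CARD('p) - 1) \<noteq> 1"
  shows "\<exists>x :: 'p padic_int. x \<noteq> 1 \<and> x ^ n = 1"
proof -
  define m where "m = gcd n (CARD('p) - 1)"
  obtain h where h: "CARD('p) - 1 = m * h"
    by (metis m_def gcd_dvd2 dvdE)
  have p1: "CARD('p) - 1 > 0"
    using prime_gt_1_nat[OF p] by simp
  then have "m * h > 0"
    by (simp only: h)
  then have "h > 0" "m > 0"
    by simp_all
  moreover have "m \<noteq> 1"
    using n by (simp add: m_def)
  ultimately have "m > 1"
    by simp
  obtain g where g: "residue_primroot CARD('p) g"
    using prime_primitive_root_exists[of "CARD('p)"] p prime_gt_1_nat[OF p] by auto
  then have ord: "ord CARD('p) g = CARD('p) - 1"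
    by (simp add: residue_primroot_def totient_prime p)
  have "[g ^ h \<noteq> 1] (mod CARD('p))"
  proof
    assume "[g ^ h = 1] (mod CARD('p))"
    then have "CARD('p) - 1 dvd h"
      using ord ord_divides by metis
    then have "m * h \<le> h"
      using h \<open>h > 0\<close> by (simp add: dvd_imp_le)
    with \<open>m > 1\<close> \<open>h > 0\<close> show False by simp
  qed
  moreover have "[int (g ^ h) ^ m = 1] (mod int CARD('p))"
  proof -
    have "[g ^ (CARD('p) - 1) = 1] (mod CARD('p))"
      using ord ord_divides by (metis dvd_refl)
    then have "[int (g ^ (CARD('p) - 1)) = int 1] (mod int CARD('p))"
      by (simp only: cong_int_iff)
    moreover have "g ^ (CARD('p) - 1) = (g ^ h) ^ m"
      by (simp only: h mult.commute[of m] power_mult)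
    ultimately show ?thesis
      by (simp only: of_nat_power of_nat_1)
  qed
  ultimately obtain x :: "'p padic_int" where x: "x \<noteq> 1" "x ^ m = 1"
    using teichmueller_root_of_unity[OF p] by blast
  moreover have "m dvd n"
    by (simp add: m_def)
  ultimately show ?thesis
    by (metis dvdE power_mult power_one)
qed

text \<open>
  From left to right, for odd \<open>p\<close> the number \<open>d\<close> is the order of the given root, which divides all
  \<open>m - 1\<close>; for \<open>p = 2\<close> it is 2, because every unit is congruent to 1 modulo 2 and thus cannot be a
  nontrivial root of unity of odd exponent. From right to left, any nontrivial \<open>d\<close>-th root of unity will
  do.
\<close>

lemma common_root_of_unity_iff:
  fixes D :: "nat set"
  assumes p: "prime CARD('p::card2)" and "D \<noteq> {}" and D1: "\<And>m. m \<in> D \<Longrightarrow> m > 1"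
  shows "(\<exists>x :: 'p padic_int. x \<noteq> 1 \<and> (\<forall>m\<in>D. x ^ (m - 1) = 1)) \<longleftrightarrow>
    (\<exists>d s n. d = CARD('p) ^ s * n \<and> n > 0 \<and> \<not> CARD('p) dvd n \<and>
       (\<forall>m\<in>D. \<exists>q>0. m = d * q + 1) \<and>
       (CARD('p) \<noteq> 2 \<longrightarrow> gcd n (CARD('p) - 1) \<noteq> 1) \<and> (CARD('p) = 2 \<longrightarrow> s = 1))"
  (is "?L \<longleftrightarrow> (\<exists>d s n. ?R d s n)")
proof
  assume ?L
  then obtain x :: "'p padic_int" where x: "x \<noteq> 1" "\<And>m. m \<in> D \<Longrightarrow> x ^ (m - 1) = 1"
    by blast
  have quot: "\<exists>q>0. m = d * q + 1" if "m \<in> D" "d dvd m - 1" for m d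
  proof -
    obtain q where "m - 1 = d * q"
      using \<open>d dvd m - 1\<close> by (rule dvdE)
    with D1[OF \<open>m \<in> D\<close>] show ?thesis
      by (intro exI[of _ q]) (auto intro: Nat.gr0I)
  qed
  show "\<exists>d s n. ?R d s n"
  proof (cases "CARD('p) = 2")
    case True
    have "2 dvd m - 1" if "m \<in> D" for m
    proof (rule ccontr)
      assume "\<not> 2 dvd m - 1"
      moreover have "of_nat CARD('p) dvd x - 1"
      proof -
        have "\<not> of_nat CARD('p) dvd x"
        proof
          assume "of_nat CARD('p) dvd x"
          then have "of_nat CARD('p) dvd x ^ (m - 1)"
            using D1[OF that] by (metis dvd_power dvd_trans zero_less_diff)
          then show False
            using x(2)[OF that] True power_CARD_dvd_of_nat_iff[where 'p='p, of 1 1] by simp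
        qed
        then show ?thesis
          using padic_fermat[OF p, of x] True by simp
      qed
      ultimately show False
        using coprime_root_of_unity_cong_1[OF p, of x "m - 1"] x(1) x(2)[OF that] True by simp
    qed
    then have "?R 2 1 1"
      using True quot by simp
    then show ?thesis by blast
  next
    case False
    define e where "e = (LEAST e. e > 0 \<and> x ^ e = 1)"
    obtain m0 where "m0 \<in> D"
      using \<open>D \<noteq> {}\<close> by blast
    have "e > 0 \<and> x ^ e = 1"
      unfolding e_def by (rule LeastI[of _ "m0 - 1"]) (use x D1 \<open>m0 \<in> D\<close> in auto)
    then have e: "e > 0" "x ^ e = 1" by auto
    have "e dvd m - 1" if "m \<in> D" for m
    proof -
      have "x ^ (e * ((m - 1) div e) + (m - 1) mod e) = 1"
        using x(2)[OF that] by simp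
      then have "x ^ ((m - 1) mod e) = 1"
        by (simp only: power_add power_mult e(2) power_one mult_1_left)
      then have "(m - 1) mod e = 0"
        using not_less_Least[of "(m - 1) mod e" "\<lambda>e. e > 0 \<and> x ^ e = 1"] e(1)
        by (auto simp: e_def[symmetric])
      then show ?thesis by auto
    qed
    then have eD: "\<forall>m\<in>D. \<exists>q>0. m = e * q + 1"
      using quot by blast
    obtain n where n: "\<not> CARD('p) dvd n" "e = CARD('p) ^ multiplicity CARD('p) e * n"
      using multiplicity_decompose'[of e "CARD('p)"] e(1) not_prime_unit[of "CARD('p)"] p
      by (metis less_irrefl_nat)
    have "gcd n (CARD('p) - 1) \<noteq> 1"
      using root_of_unity_exponent_not_coprime[OF p False n(1), of x] n(2) e(2) x(1) by metis
    then have "?R e (multiplicity CARD('p) e) n"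
      using n eD False e(1) by (auto intro: Nat.gr0I)
    then show ?thesis by blast
  qed
next
  assume "\<exists>d s n. ?R d s n"
  then obtain d s n where R: "?R d s n" by blast
  obtain x :: "'p padic_int" where x: "x \<noteq> 1" "x ^ d = 1"
  proof (cases "CARD('p) = 2")
    case True
    have "(-1 :: 'p padic_int) ^ d = 1"
      using R True by simp
    with minus_one_neq_one show ?thesis by (rule that)
  next
    case False
    then have "gcd n (CARD('p) - 1) \<noteq> 1"
      using R by simp
    then obtain x :: "'p padic_int" where x: "x \<noteq> 1" "x ^ n = 1"
      using exists_nontrivial_root_of_unity[OF p] by blast
    then have "x ^ (n * CARD('p) ^ s) = 1"
      by (simp only: power_mult power_one)
    then have "x ^ d = 1"
      using R by (simp only: mult.commute)
    with x(1) show ?thesis by (rule that)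
  qed
  have "x ^ (m - 1) = 1" if "m \<in> D" for m
  proof -
    obtain q where "m = d * q + 1"
      using R \<open>m \<in> D\<close> by blast
    then show ?thesis
      using x(2) by (simp add: power_mult)
  qed
  with x(1) show ?L by blast
qed

section \<open>Convergent series\<close>

text \<open>
  Rephrasing limits by divisibility reduces the arithmetic of convergent series to dividing finite
  sums by powers of \<open>p\<close>.
\<close>

lemma padic_tendsto_iff:
  fixes X :: "nat \<Rightarrow> 'p::card2 padic_int"
  shows "X \<longlonglongrightarrow> L \<longleftrightarrow> (\<forall>k. \<forall>\<^sub>F n in sequentially. of_nat CARD('p) ^ k dvd X n - L)"
proof
  assume *: "X \<longlonglongrightarrow> L"
  show "\<forall>k. \<forall>\<^sub>F n in sequentially. of_nat CARD('p) ^ k dvd X n - L"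
  proof
    fix k
    have "\<forall>\<^sub>F n in sequentially. dist (X n) L < 1 / real CARD('p) ^ k"
      using * by (rule tendstoD) simp
    then show "\<forall>\<^sub>F n in sequentially. of_nat CARD('p) ^ k dvd X n - L"
      by eventually_elim (simp flip: dist_padic_int_le_iff)
  qed
next
  assume *: "\<forall>k. \<forall>\<^sub>F n in sequentially. of_nat CARD('p) ^ k dvd X n - L"
  show "X \<longlonglongrightarrow> L"
  proof (rule tendstoI)
    fix e :: real
    assume "e > 0"
    have "1 / real CARD('p) < 1"
      using two_le_card[where 'a='p] by simp
    then obtain k where "(1 / real CARD('p)) ^ k < e"
      using real_arch_pow_inv[OF \<open>e > 0\<close>] by blast
    then have k: "1 / real CARD('p) ^ k < e"
      by (simp add: power_one_over)
    from * have "\<forall>\<^sub>F n in sequentially. of_nat CARD('p) ^ k dvd X n - L" by blast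
    then show "\<forall>\<^sub>F n in sequentially. dist (X n) L < e"
      by eventually_elim (use k in \<open>simp add: order_le_less_trans flip: dist_padic_int_le_iff\<close>)
  qed
qed

lemma padic_sums_iff:
  fixes f :: "nat \<Rightarrow> 'p::card2 padic_int"
  shows "f sums s \<longleftrightarrow> (\<forall>k. \<forall>\<^sub>F n in sequentially. of_nat CARD('p) ^ k dvd sum f {..<n} - s)"
  by (simp add: sums_def padic_tendsto_iff)

lemma padic_sums_mult:
  fixes f :: "nat \<Rightarrow> 'p::card2 padic_int"
  assumes "f sums s"
  shows "(\<lambda>n. u * f n) sums (u * s)"
  unfolding padic_sums_iff
proof
  fix k
  have "\<forall>\<^sub>F n in sequentially. of_nat CARD('p) ^ k dvd sum f {..<n} - s"
    using assms unfolding padic_sums_iff by blast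
  then show "\<forall>\<^sub>F n in sequentially. of_nat CARD('p) ^ k dvd (\<Sum>i<n. u * f i) - u * s"
    by eventually_elim (simp flip: sum_distrib_left right_diff_distrib)
qed

lemma padic_sums_diff:
  fixes f g :: "nat \<Rightarrow> 'p::card2 padic_int"
  assumes "f sums s" and "g sums t"
  shows "(\<lambda>n. f n - g n) sums (s - t)"
  unfolding padic_sums_iff
proof
  fix k
  have "\<forall>\<^sub>F n in sequentially. of_nat CARD('p) ^ k dvd sum f {..<n} - s"
    and "\<forall>\<^sub>F n in sequentially. of_nat CARD('p) ^ k dvd sum g {..<n} - t"
    using assms unfolding padic_sums_iff by blast+
  then show "\<forall>\<^sub>F n in sequentially. of_nat CARD('p) ^ k dvd (\<Sum>i<n. f i - g i) - (s - t)"
  proof eventually_elim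
    case (elim n)
    then have "of_nat CARD('p) ^ k dvd (sum f {..<n} - s) - (sum g {..<n} - t)"
      by (rule dvd_diff)
    then show ?case
      by (simp add: sum_subtractf algebra_simps)
  qed
qed

text \<open>
  Take \<open>t = p ^ k\<close>. If all coefficients before \<open>a m\<close> vanish, the partial sums are
  \<open>t\<^sup>m (a m + t r)\<close> with some \<open>r\<close>. They tend to 0, so \<open>p ^ k\<close> divides \<open>a m + t r\<close> and therefore
  \<open>a m\<close>. As \<open>k\<close> is arbitrary, \<open>a m = 0\<close>.
\<close>

lemma padic_power_series_eq_0:
  fixes a :: "nat \<Rightarrow> 'p::card2 padic_int"
  assumes zero: "\<And>t. (\<lambda>n. a n * t ^ n) sums 0"
  shows "a n = 0"
proof (induction n rule: less_induct)
  case (less m)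
  have "of_nat CARD('p) ^ k dvd a m" for k
  proof -
    define t :: "'p padic_int" where "t = of_nat CARD('p) ^ k"
    have "\<forall>\<^sub>F n in sequentially. of_nat CARD('p) ^ (k * m + k) dvd (\<Sum>i<n. a i * t ^ i)"
      using zero[of t] unfolding padic_sums_iff by simp
    then obtain N where N: "\<And>n. n \<ge> N \<Longrightarrow> of_nat CARD('p) ^ (k * m + k) dvd (\<Sum>i<n. a i * t ^ i)"
      unfolding eventually_sequentially by blast
    define r where "r = (\<Sum>i<N. a (Suc m + i) * t ^ i)"
    have "(\<Sum>i<Suc m + N. a i * t ^ i)
        = (\<Sum>i<Suc m. a i * t ^ i) + (\<Sum>i<N. a (Suc m + i) * t ^ (Suc m + i))"
      by (induction N) (simp_all add: add.assoc)
    also have "(\<Sum>i<Suc m. a i * t ^ i) = a m * t ^ m"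
      using less by simp
    also have "(\<Sum>i<N. a (Suc m + i) * t ^ (Suc m + i)) = t ^ m * (t * r)"
      unfolding r_def sum_distrib_left by (rule sum.cong) (simp_all add: power_add mult_ac)
    finally have "(\<Sum>i<Suc m + N. a i * t ^ i) = of_nat CARD('p) ^ (k * m) * (a m + t * r)"
      by (simp add: t_def power_mult algebra_simps)
    moreover have "of_nat CARD('p) ^ (k * m + k) dvd (\<Sum>i<Suc m + N. a i * t ^ i)"
      by (rule N) simp
    ultimately have "of_nat CARD('p) ^ (k * m + k) dvd of_nat CARD('p) ^ (k * m) * (a m + t * r)"
      by (simp only:)
    then have "of_nat CARD('p) ^ k dvd a m + t * r"
      by (rule CARD_power_mult_dvd_cancel)
    then have "of_nat CARD('p) ^ k dvd a m + t * r - t * r"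
      by (rule dvd_diff) (simp add: t_def)
    then show ?thesis by simp
  qed
  then show ?case
    using padic_int_eq_0_iff by blast
qed

lemma homogeneous_part_eq_sum:
  "homogeneous_part C n x y = (\<Sum>i\<le>n. C i (n - i) * x ^ i * y ^ (n - i))"
  unfolding homogeneous_part_def
  by (rule sum.reindex_bij_witness[where i = "\<lambda>i. (i, n - i)" and j = fst]) auto

lemma homogeneous_part_scale:
  "homogeneous_part C n (u * x) (u * y) = u ^ n * homogeneous_part C n x y"
  unfolding homogeneous_part_eq_sum sum_distrib_left
proof (rule sum.cong[OF refl])
  fix i assume "i \<in> {..n}"
  then have "u ^ n = u ^ i * u ^ (n - i)"
    by (simp flip: power_add)
  then show "C i (n - i) * (u * x) ^ i * (u * y) ^ (n - i) = u ^ n * (C i (n - i) * x ^ i * y ^ (n - i))"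
    by (simp add: power_mult_distrib mult_ac)
qed

text \<open>
  Setting \<open>y = 1\<close> turns the homogeneous part into a polynomial in \<open>x\<close> with the same coefficients; a
  polynomial is a convergent power series, so the uniqueness of coefficients applies. The factor \<open>u\<close>
  is absorbed into the coefficients.
\<close>

lemma homogeneous_part_eq_0D:
  fixes C :: "nat \<Rightarrow> nat \<Rightarrow> 'p::card2 padic_int"
  assumes zero: "\<And>x. u * homogeneous_part C n x 1 = 0" and "i + j = n"
  shows "u * C i j = 0"
proof -
  define a where "a k = (if k \<le> n then u * C k (n - k) else 0)" for k
  have "(\<lambda>k. a k * t ^ k) sums 0" for t
  proof -
    have "(\<lambda>k. a k * t ^ k) sums (\<Sum>k\<le>n. a k * t ^ k)"
      by (rule sums_finite) (auto simp: a_def)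
    also have "(\<Sum>k\<le>n. a k * t ^ k) = u * homogeneous_part C n t 1"
      unfolding homogeneous_part_eq_sum sum_distrib_left
      by (rule sum.cong) (auto simp: a_def mult_ac)
    finally show ?thesis
      using zero by simp
  qed
  then have "a i = 0"
    by (rule padic_power_series_eq_0)
  with \<open>i + j = n\<close> show ?thesis
    by (auto simp: a_def)
qed

section \<open>Automorphisms\<close>

text \<open>
  Additivity gives \<open>f m = f 1 * m\<close> for natural numbers \<open>m\<close>, and modulo each \<open>p ^ k\<close> every \<open>x\<close> is such
  a number. The proof approximates modulo \<open>p ^ Suc k\<close> because congruences are preserved only for
  positive exponents.
\<close>

lemma padic_linear_if_additive_and_congruence_preserving:
  fixes f :: "'p::card2 padic_int \<Rightarrow> 'p padic_int"
  assumes add: "\<And>x y. f (x + y) = f x + f y"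
    and cong: "\<And>k x y. k \<ge> 1 \<Longrightarrow> padic_cong k x y \<Longrightarrow> padic_cong k (f x) (f y)"
  shows "f x = f 1 * x"
proof -
  have f_of_nat: "f (of_nat m) = f 1 * of_nat m" for m
  proof (induction m)
    case 0
    then show ?case using add[of 0 0] by simp
  next
    case (Suc m)
    then show ?case by (simp add: add algebra_simps)
  qed
  have "of_nat CARD('p) ^ k dvd f x - f 1 * x" for k
  proof -
    obtain m where m: "of_nat CARD('p) ^ Suc k dvd x - of_nat m"
      by (rule nat_approx)
    then have "of_nat CARD('p) ^ Suc k dvd f x - f (of_nat m)"
      using cong[of "Suc k" x "of_nat m"] by (simp add: padic_cong_def)
    moreover have "of_nat CARD('p) ^ Suc k dvd f 1 * (x - of_nat m)"
      using m by (rule dvd_mult)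
    ultimately have "of_nat CARD('p) ^ Suc k dvd f x - f (of_nat m) - f 1 * (x - of_nat m)"
      by (rule dvd_diff)
    then have "of_nat CARD('p) ^ Suc k dvd f x - f 1 * x"
      by (simp add: f_of_nat algebra_simps)
    then show ?thesis
      by (rule power_le_dvd) simp
  qed
  then have "f x - f 1 * x = 0"
    using padic_int_eq_0_iff by blast
  then show ?thesis by simp
qed

lemma padic_automorphism_iff_mult:
  fixes f :: "'p::card2 padic_int \<Rightarrow> 'p padic_int"
  shows "padic_automorphism G f \<longleftrightarrow>
    (\<exists>u. u dvd 1 \<and> f = (*) u \<and> (\<forall>x y. u * G x y = G (u * x) (u * y)))"
proof
  assume f: "padic_automorphism G f"
  then have lin: "f x = f 1 * x" for x
    by (intro padic_linear_if_additive_and_congruence_preserving) (auto simp: padic_automorphism_def)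
  obtain z where "f z = 1"
    using f by (metis padic_automorphism_def bij_pointE)
  then have "f 1 dvd 1"
    using lin[of z] by (metis dvd_triv_left)
  moreover have "f = (*) (f 1)"
    using lin by blast
  moreover have "f (G x y) = G (f x) (f y)" for x y
    using f by (simp add: padic_automorphism_def)
  ultimately show "\<exists>u. u dvd 1 \<and> f = (*) u \<and> (\<forall>x y. u * G x y = G (u * x) (u * y))"
    by metis
next
  assume "\<exists>u. u dvd 1 \<and> f = (*) u \<and> (\<forall>x y. u * G x y = G (u * x) (u * y))"
  then obtain u v where u: "1 = u * v" and f: "f = (*) u" and G: "\<And>x y. u * G x y = G (u * x) (u * y)"
    by (auto simp: dvd_def)
  have "bij f"
    unfolding f
  proof (rule o_bij)
    show "(*) v \<circ> (*) u = id"
      using u by (simp add: fun_eq_iff mult.commute[of v] flip: mult.assoc)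
    show "(*) u \<circ> (*) v = id"
      using u by (simp add: fun_eq_iff flip: mult.assoc)
  qed
  then show "padic_automorphism G f"
    by (simp add: padic_automorphism_def f G padic_cong_def distrib_left flip: right_diff_distrib)
qed

text \<open>
  Both sides are convergent series whose terms of degree \<open>n\<close> are \<open>u\<close> and \<open>u\<^sup>n\<close> times the homogeneous
  part of \<open>G\<close>. Comparing the values at the origin separates the constant term; comparing along the
  lines \<open>t \<mapsto> (t x, t y)\<close> then separates the degrees. That \<open>u\<close> is a unit allows passing from
  \<open>u\<^sup>n = u\<close> to \<open>u\<^bsup>n-1\<^esup> = 1\<close>.
\<close>

lemma scaling_commutes_with_series_iff:
  fixes G :: "'p::card2 padic_int \<Rightarrow> 'p padic_int \<Rightarrow> 'p padic_int"
  assumes p: "prime CARD('p)"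
    and series: "\<And>x y. (\<lambda>n. if n \<in> degree_set C then homogeneous_part C n x y else 0)
                    sums (G x y - (c + a * x + b * y))"
    and "u dvd 1"
  shows "(\<forall>x y. u * G x y = G (u * x) (u * y)) \<longleftrightarrow>
    (u - 1) * c = 0 \<and> (\<forall>n\<in>degree_set C. u ^ (n - 1) = 1)"
proof
  let ?H = "\<lambda>n x y. if n \<in> degree_set C then homogeneous_part C n x y else 0"
  assume comm: "\<forall>x y. u * G x y = G (u * x) (u * y)"
  have "(\<lambda>n. ?H n 0 0) = (\<lambda>n. 0)"
    by (auto simp: homogeneous_part_eq_sum degree_set_def power_0_left intro!: ext sum.neutral)
  then have "G 0 0 - c = 0"
    using series[of 0 0] sums_unique2 sums_zero by fastforce
  then have c: "(u - 1) * c = 0"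
    using comm[rule_format, of 0 0] by (simp add: algebra_simps)
  have coeff: "(u - u ^ n) * ?H n x y = 0" for n x y
  proof (rule padic_power_series_eq_0[where a = "\<lambda>n. (u - u ^ n) * ?H n x y"])
    fix t
    have "(\<lambda>n. u * ?H n (t * x) (t * y) - ?H n (u * (t * x)) (u * (t * y))) sums
        (u * (G (t * x) (t * y) - (c + a * (t * x) + b * (t * y)))
         - (G (u * (t * x)) (u * (t * y)) - (c + a * (u * (t * x)) + b * (u * (t * y)))))"
      by (intro padic_sums_diff padic_sums_mult series)
    also have "(\<lambda>n. u * ?H n (t * x) (t * y) - ?H n (u * (t * x)) (u * (t * y)))
        = (\<lambda>n. (u - u ^ n) * ?H n x y * t ^ n)"
      by (auto simp: homogeneous_part_scale algebra_simps)
    also have "u * (G (t * x) (t * y) - (c + a * (t * x) + b * (t * y)))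
         - (G (u * (t * x)) (u * (t * y)) - (c + a * (u * (t * x)) + b * (u * (t * y)))) = - ((u - 1) * c)"
      using comm by (simp add: algebra_simps)
    finally show "(\<lambda>n. (u - u ^ n) * ?H n x y * t ^ n) sums 0"
      using c by simp
  qed
  have "u ^ (n - 1) = 1" if n: "n \<in> degree_set C" for n
  proof -
    obtain i j where ij: "i + j = n" "C i j \<noteq> 0" and "n > 1"
      using n by (auto simp: degree_set_def)
    have "(u - u ^ n) * homogeneous_part C n x 1 = 0" for x
      using coeff[of n x 1] n by (simp only: if_True)
    then have "(u - u ^ n) * C i j = 0"
      using ij(1) by (rule homogeneous_part_eq_0D)
    then have "u - u ^ n = 0"
      using padic_int_no_zero_divisors[OF p] ij(2) by blast
    moreover have "u ^ n = u * u ^ (n - 1)"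
      using \<open>n > 1\<close> by (simp flip: power_Suc)
    ultimately have "u * u ^ (n - 1) = u"
      by simp
    moreover obtain v where "1 = u * v"
      using \<open>u dvd 1\<close> by (rule dvdE)
    ultimately show ?thesis
      by (metis mult.assoc mult.commute mult_1_left)
  qed
  with c show "(u - 1) * c = 0 \<and> (\<forall>n\<in>degree_set C. u ^ (n - 1) = 1)"
    by blast
next
  let ?H = "\<lambda>n x y. if n \<in> degree_set C then homogeneous_part C n x y else 0"
  assume u: "(u - 1) * c = 0 \<and> (\<forall>n\<in>degree_set C. u ^ (n - 1) = 1)"
  have un: "u ^ n = u" if "n \<in> degree_set C" for n
  proof -
    have "u ^ n = u * u ^ (n - 1)"
      using that by (simp add: degree_set_def flip: power_Suc)
    with u that show ?thesis by simp
  qed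
  show "\<forall>x y. u * G x y = G (u * x) (u * y)"
  proof (intro allI)
    fix x y
    have "(\<lambda>n. ?H n (u * x) (u * y)) = (\<lambda>n. u * ?H n x y)"
      by (auto simp: homogeneous_part_scale un)
    then have "(\<lambda>n. u * ?H n x y) sums (G (u * x) (u * y) - (c + a * (u * x) + b * (u * y)))"
      using series[of "u * x" "u * y"] by simp
    with padic_sums_mult[OF series[of x y], of u]
    have "u * (G x y - (c + a * x + b * y)) = G (u * x) (u * y) - (c + a * (u * x) + b * (u * y))"
      by (rule sums_unique2)
    then have "u * G x y - G (u * x) (u * y) = (u - 1) * c"
      by (simp add: algebra_simps)
    with u show "u * G x y = G (u * x) (u * y)"
      by simp
  qed
qed

lemma nontrivial_padic_Aut_iff:
  fixes G :: "'p::card2 padic_int \<Rightarrow> 'p padic_int \<Rightarrow> 'p padic_int"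
  assumes p: "prime CARD('p)"
    and series: "\<And>x y. (\<lambda>n. if n \<in> degree_set C then homogeneous_part C n x y else 0)
                    sums (G x y - (c + a * x + b * y))"
  shows "\<not> trivial_group (padic_Aut G) \<longleftrightarrow>
    c = 0 \<and> (\<exists>u :: 'p padic_int. u dvd 1 \<and> u \<noteq> 1 \<and> (\<forall>n\<in>degree_set C. u ^ (n - 1) = 1))"
proof -
  have mult_id: "(*) u = id \<longleftrightarrow> u = 1" for u :: "'p padic_int"
    by (metis mult.right_neutral id_apply eq_id_iff mult_1_left)
  have cancel: "(u - 1) * c = 0 \<longleftrightarrow> c = 0" if "u \<noteq> 1" for u
    using padic_int_no_zero_divisors[OF p, of "u - 1" c] that by auto
  have equivariant: "u dvd 1 \<and> u \<noteq> 1 \<and> (\<forall>x y. u * G x y = G (u * x) (u * y)) \<longleftrightarrow>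
      u dvd 1 \<and> u \<noteq> 1 \<and> c = 0 \<and> (\<forall>n\<in>degree_set C. u ^ (n - 1) = 1)" for u
  proof (cases "u dvd 1 \<and> u \<noteq> 1")
    case True
    then show ?thesis
      using scaling_commutes_with_series_iff[OF p series, of u] cancel[of u] by (simp only: simp_thms)
  qed blast
  have "\<not> trivial_group (padic_Aut G) \<longleftrightarrow>
      (\<exists>u. u dvd 1 \<and> u \<noteq> 1 \<and> (\<forall>x y. u * G x y = G (u * x) (u * y)))"
    unfolding trivial_group_padic_Aut_iff padic_automorphism_iff_mult using mult_id by blast
  also have "\<dots> \<longleftrightarrow> c = 0 \<and> (\<exists>u :: 'p padic_int. u dvd 1 \<and> u \<noteq> 1 \<and> (\<forall>n\<in>degree_set C. u ^ (n - 1) = 1))"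
    unfolding equivariant by blast
  finally show ?thesis .
qed

theorem proposition2p6:
  fixes p :: nat
    and G :: "'p::card2 padic_int \<Rightarrow> 'p padic_int \<Rightarrow> 'p padic_int"
    and a b c :: "'p padic_int"
    and C :: "nat \<Rightarrow> nat \<Rightarrow> 'p padic_int"
  defines "cond_i \<equiv>
      c = 0 \<and>
      (\<exists>d s n. d = p ^ s * n \<and> n > 0 \<and> \<not> p dvd n \<and>
         (\<forall>m\<in>degree_set C. \<exists>q>0. m = d * q + 1) \<and>
         (p \<noteq> 2 \<longrightarrow> gcd n (p - 1) \<noteq> 1) \<and>
         (p = 2 \<longrightarrow> s = 1))"
    and "cond_ii \<equiv> (\<forall>x y. G x y = a * x + b * y) \<and> a \<noteq> 0 \<and> b \<noteq> 0"
  assumes "prime p" and "CARD('p) = p"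
    and series: "\<And>x y. (\<lambda>n. if n \<in> degree_set C then homogeneous_part C n x y else 0)
                    sums (G x y - (c + a * x + b * y))"
    and "degree_set C = {} \<Longrightarrow> a \<noteq> 0 \<and> b \<noteq> 0"
  shows "(degree_set C \<noteq> {} \<longrightarrow> (\<not> trivial_group (padic_Aut G) \<longleftrightarrow> cond_i)) \<and>
         (degree_set C = {} \<longrightarrow> (\<not> trivial_group (padic_Aut G) \<longleftrightarrow> cond_ii)) \<and>
         (\<not> (degree_set C \<noteq> {} \<and> cond_i) \<and> \<not> (degree_set C = {} \<and> cond_ii)
            \<longrightarrow> trivial_group (padic_Aut G))"
proof -
  have p: "prime CARD('p)" and p_eq: "p = CARD('p)"
    using \<open>prime p\<close> \<open>CARD('p) = p\<close> by simp_all
  note nontrivial = nontrivial_padic_Aut_iff[OF p series]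
  have "\<not> trivial_group (padic_Aut G) \<longleftrightarrow> cond_i" if D: "degree_set C \<noteq> {}"
  proof -
    have D1: "n > 1" if "n \<in> degree_set C" for n
      using that by (simp add: degree_set_def)
    have unit: "u dvd 1" if u: "\<forall>n\<in>degree_set C. u ^ (n - 1) = 1" for u :: "'p padic_int"
    proof -
      obtain n where n: "n \<in> degree_set C"
        using D by blast
      then have "u dvd u ^ (n - 1)"
        using D1 by (intro dvd_power) simp
      with u n show ?thesis by simp
    qed
    \<comment> \<open>Roots of unity are units, so the unit condition can be dropped.\<close>
    have "u dvd 1 \<and> u \<noteq> 1 \<and> (\<forall>n\<in>degree_set C. u ^ (n - 1) = 1)
        \<longleftrightarrow> u \<noteq> 1 \<and> (\<forall>n\<in>degree_set C. u ^ (n - 1) = 1)" for u :: "'p padic_int"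
      using unit[of u] by satx
    then have "\<not> trivial_group (padic_Aut G) \<longleftrightarrow>
        c = 0 \<and> (\<exists>u :: 'p padic_int. u \<noteq> 1 \<and> (\<forall>n\<in>degree_set C. u ^ (n - 1) = 1))"
      unfolding nontrivial by presburger
    then show ?thesis
      unfolding cond_i_def p_eq using common_root_of_unity_iff[OF p D D1] by (simp only: simp_thms)
  qed
  moreover have "\<not> trivial_group (padic_Aut G) \<longleftrightarrow> cond_ii" if D: "degree_set C = {}"
  proof -
    have "(-1 :: 'p padic_int) dvd 1" "(-1 :: 'p padic_int) \<noteq> 1"
      using minus_one_neq_one by auto
    then have "\<not> trivial_group (padic_Aut G) \<longleftrightarrow> c = 0"
      unfolding nontrivial D by blast
    moreover have "G x y = c + a * x + b * y" for x y
    proof -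
      have "(\<lambda>n. 0) sums (G x y - (c + a * x + b * y))"
        using series[of x y] D by simp
      then have "G x y - (c + a * x + b * y) = 0"
        using sums_unique2 sums_zero by blast
      then show ?thesis by simp
    qed
    moreover have "a \<noteq> 0 \<and> b \<noteq> 0"
      using assms(6) D by blast
    ultimately show ?thesis
      unfolding cond_ii_def by (metis add_cancel_left_left mult_zero_right add.right_neutral add_0)
  qed
  ultimately show ?thesis by blast
qed

end
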